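(* Let $f:\mathbf{R}^n\to[0,\infty]$ be a quasi-concave function such that $f\in L^1(\mathbf{R}^n)$. Then $$\int_{\mathbf{R}^n}\Delta_{-\infty}f(x)\,dx\le\frac{1}{2^n}\binom{2n}{n}\int_{\mathbf{R}^n}f(x)\,dx .$$
   Context: A function $f:\mathbf{R}^n\to[0,\infty]$ is quasi-concave if $f(tx+(1-t)y)\ge\min\{f(x),f(y)\}$ for all $x,y\in\mathbf{R}^n$ and all $t\in[0,1]$. The difference function of order $-\infty$ of $f:\mathbf{R}^n\to[0,\infty]$ is $$\Delta_{-\infty}f(z)=\sup\left\{\min\{f(x),f(-y)\}\;:\;x,y\in\mathbf{R}^n,\ \tfrac12(x+y)=z\right\},\quad z\in\mathbf{R}^n.$$ *)

theory Defs
  imports "HOL-Analysis.Analysis"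
begin

definition quasi_concave :: "('a::real_vector \<Rightarrow> ennreal) \<Rightarrow> bool" where
  "quasi_concave f \<longleftrightarrow>
     (\<forall>x y. \<forall>t\<in>{0..1::real}. f (t *\<^sub>R x + (1 - t) *\<^sub>R y) \<ge> min (f x) (f y))"

definition difference_function_minus_infinity :: "('a::real_vector \<Rightarrow> ennreal) \<Rightarrow> 'a \<Rightarrow> ennreal" where
  "difference_function_minus_infinity f z = Sup {min (f x) (f (- y)) | x y. (1 / 2 :: real) *\<^sub>R (x + y) = z}"

text \<open>
  Membership in L1 for functions with values in [0, infinity]. Measurability is with respect to
  the completed Lebesgue measure: a quasi-concave function need not be Borel measurable.
\<close>

definition in_L1 :: "('a::euclidean_space \<Rightarrow> ennreal) \<Rightarrow> bool" where
  "in_L1 f \<longleftrightarrow> f \<in> borel_measurable lebesgue \<and> (\<integral>\<^sup>+ x. f x \<partial>lebesgue) < \<infinity>"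

end

theory Submission
  imports Defs
begin

text \<open>
  The superlevel set of the difference function at height \<open>t\<close> is \<open>(K - K) / 2\<close>, where \<open>K\<close> is the
  convex superlevel set of \<open>f\<close> at height \<open>t\<close>. By the layer-cake formula it therefore suffices to
  prove the Rogers--Shephard inequality for convex sets \<open>K\<close>. If \<open>z = r (a - b)\<close> with \<open>a, b \<in> K\<close>
  and \<open>0 < r < 1\<close>, then \<open>K \<inter> (K + z)\<close> contains \<open>(1 - r) K + r a\<close>, so its volume is at least
  \<open>(1 - r)^n vol K\<close>. Integrating over \<open>z\<close> gives \<open>(vol K)^2\<close> on one side, and on the other
  \<open>vol K vol (K - K)\<close> times the Beta integral of \<open>n (1 - r)^(n - 1) r^n\<close> over \<open>[0, 1]\<close>, which
  is the reciprocal of the central binomial coefficient.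
\<close>

section \<open>Layer-cake formula in sigma-finite measure spaces\<close>

lemma sigma_finite_measure_completion:
  assumes "sigma_finite_measure M"
  shows "sigma_finite_measure (completion M)"
proof
  obtain A where "countable A" "A \<subseteq> sets M" "\<Union>A = space M" "\<forall>a\<in>A. emeasure M a \<noteq> \<infinity>"
    using sigma_finite_measure.sigma_finite_countable[OF assms] by blast
  then show "\<exists>A. countable A \<and> A \<subseteq> sets (completion M) \<and> \<Union>A = space (completion M) \<and>
      (\<forall>a\<in>A. emeasure (completion M) a \<noteq> \<infinity>)"
    by (intro exI[of _ A]) auto
qed

context sigma_finite_measure
begin

text \<open>Sections of a measurable subset of the product have measurable measure. This lets
  constants be pulled out of the layer-cake integral.\<close>

lemma borel_measurable_emeasure_superlevel:
  fixes f :: "'a \<Rightarrow> ennreal"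
  assumes [measurable]: "f \<in> borel_measurable M"
  shows "(\<lambda>t. emeasure M {x \<in> space M. ennreal t < f x}) \<in> borel_measurable lborel"
proof -
  have "{p \<in> space (lborel \<Otimes>\<^sub>M M). ennreal (fst p) < f (snd p)} \<in> sets (lborel \<Otimes>\<^sub>M M)"
    by measurable
  from measurable_emeasure_Pair[OF this] show ?thesis
    by (rule measurable_cong[THEN iffD1, rotated])
       (auto simp: space_pair_measure intro!: arg_cong[where f="emeasure M"])
qed

text \<open>Each value \<open>f x\<close> is the length of the set of heights \<open>t > 0\<close>
  below it; Tonelli then swaps the integrals. The factor \<open>indicator {0<..} t\<close> matters
  because \<open>ennreal\<close> sends negative reals to 0, so negative heights would contribute
  wherever \<open>f\<close> is positive.\<close>

lemma nn_integral_eq_nn_integral_superlevel: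
  fixes f :: "'a \<Rightarrow> ennreal"
  assumes f [measurable]: "f \<in> borel_measurable M"
  shows "(\<integral>\<^sup>+x. f x \<partial>M) =
    (\<integral>\<^sup>+t. emeasure M {x \<in> space M. ennreal t < f x} * indicator {0<..} t \<partial>lborel)"
proof -
  interpret pair_sigma_finite lborel M ..
  have slice: "(\<integral>\<^sup>+t. indicator {t. 0 < t \<and> ennreal t < c} t \<partial>lborel) = c" for c
  proof (cases c rule: ennreal_cases)
    case (real r)
    then have "{t. 0 < t \<and> ennreal t < c} = {0<..<r}"
      by (auto simp: ennreal_less_iff)
    with real show ?thesis by simp
  next
    case top
    then have "{t. 0 < t \<and> ennreal t < c} = {0<..}" by auto
    moreover have "emeasure lborel {0::real<..} = \<infinity>"
    proof (cases "emeasure lborel {0::real<..}" rule: ennreal_cases)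
      case (real r)
      \<comment> \<open>A half-line of finite length \<open>r\<close> would contain an interval of
        length \<open>r + 1\<close>.\<close>
      have "emeasure lborel {0<..<r + 1} \<le> emeasure lborel {0::real<..}"
        by (intro emeasure_mono) auto
      with real show ?thesis by simp
    qed simp
    ultimately show ?thesis using top by simp
  qed
  have "(\<integral>\<^sup>+x. f x \<partial>M) = (\<integral>\<^sup>+x. \<integral>\<^sup>+t. indicator {t. 0 < t \<and> ennreal t < f x} t \<partial>lborel \<partial>M)"
    by (simp only: slice)
  also have "\<dots> = (\<integral>\<^sup>+x. \<integral>\<^sup>+t. indicator {p. 0 < fst p \<and> ennreal (fst p) < f (snd p)} (t, x) \<partial>lborel \<partial>M)"
    by (auto intro!: nn_integral_cong simp: indicator_def)
  also have "\<dots> = (\<integral>\<^sup>+t. \<integral>\<^sup>+x. indicator {p. 0 < fst p \<and> ennreal (fst p) < f (snd p)} (t, x) \<partial>M \<partial>lborel)"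
  proof (rule Fubini')
    have "Measurable.pred (lborel \<Otimes>\<^sub>M M) (\<lambda>p. 0 < fst p \<and> ennreal (fst p) < f (snd p))"
      by measurable
    then show "(\<lambda>(t, x). indicator {p. 0 < fst p \<and> ennreal (fst p) < f (snd p)} (t, x))
      \<in> borel_measurable (lborel \<Otimes>\<^sub>M M)"
      by (simp add: case_prod_eta)
  qed
  also have "\<dots> = (\<integral>\<^sup>+t. \<integral>\<^sup>+x. indicator {x \<in> space M. ennreal t < f x} x * indicator {0<..} t \<partial>M \<partial>lborel)"
    by (intro nn_integral_cong) (auto simp: indicator_def)
  also have "\<dots> = (\<integral>\<^sup>+t. emeasure M {x \<in> space M. ennreal t < f x} * indicator {0<..} t \<partial>lborel)"
    by (intro nn_integral_cong) (simp add: nn_integral_multc)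
  finally show ?thesis .
qed

lemma nn_integral_le_if_superlevel_le:
  fixes f g :: "'a \<Rightarrow> ennreal"
  assumes f: "f \<in> borel_measurable M" and g: "g \<in> borel_measurable M"
    and le: "\<And>t. 0 < t \<Longrightarrow> emeasure M {x \<in> space M. ennreal t < g x}
      \<le> c * emeasure M {x \<in> space M. ennreal t < f x}"
  shows "(\<integral>\<^sup>+x. g x \<partial>M) \<le> c * (\<integral>\<^sup>+x. f x \<partial>M)"
proof -
  note [measurable] = borel_measurable_emeasure_superlevel[OF f]
  have "(\<integral>\<^sup>+x. g x \<partial>M) \<le>
      (\<integral>\<^sup>+t. c * (emeasure M {x \<in> space M. ennreal t < f x} * indicator {0<..} t) \<partial>lborel)"
    unfolding nn_integral_eq_nn_integral_superlevel[OF g]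
    by (intro nn_integral_mono) (auto simp: indicator_def intro: le)
  also have "\<dots> = c * (\<integral>\<^sup>+x. f x \<partial>M)"
    unfolding nn_integral_eq_nn_integral_superlevel[OF f]
    by (intro nn_integral_cmult) measurable
  finally show ?thesis .
qed

end

section \<open>Convex sets and difference bodies\<close>

text \<open>Bounded convex sets are Lebesgue measurable, and a convex set is the countable union of
  its intersections with balls.\<close>

lemma convex_imp_sets_lebesgue:
  fixes S :: "'a::euclidean_space set"
  assumes "convex S"
  shows "S \<in> sets lebesgue"
proof -
  have "S = (\<Union>n. S \<inter> cball 0 (real n))"
    by (auto simp: real_arch_simple)
  moreover have "S \<inter> cball 0 (real n) \<in> sets lebesgue" for n
    using assms by (intro fmeasurableD measurable_convex) (auto intro: convex_Int)
  ultimately show ?thesis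
    by (metis (no_types, lifting) sets.countable_UN rangeI image_subsetI)
qed

abbreviation difference_body :: "'a::ab_group_add set \<Rightarrow> 'a set" where
  "difference_body K \<equiv> {a - b | a b. a \<in> K \<and> b \<in> K}"

lemma convex_difference_body:
  assumes "convex K"
  shows "convex (difference_body K)"
proof -
  have "difference_body K = (\<Union>x\<in>K. \<Union>y\<in>K. {x - y})" by auto
  with convex_differences[OF assms assms] show ?thesis by simp
qed

lemma open_difference_body:
  fixes K :: "'a::real_normed_vector set"
  assumes "open K"
  shows "open (difference_body K)"
proof -
  have "difference_body K = (\<Union>b\<in>K. (\<lambda>x. x - b) ` K)" by auto
  with open_translation_subtract[OF assms] show ?thesis by (auto intro!: open_UN)
qed

section \<open>Two one-dimensional integrals\<close>

text \<open>The value is \<open>n * Beta (n + 1) n\<close>, that is n (n! (n-1)!) / (2n)! = (n!)^2 /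
  (2n)!.\<close>

lemma nn_integral_Beta_nat:
  assumes "n > 0"
  shows "(\<integral>\<^sup>+r. ennreal (n * (1 - r) ^ (n - 1) * r ^ n) * indicator {0<..<1} r \<partial>lborel) =
    ennreal (1 / real ((2 * n) choose n))"
proof -
  have "((\<lambda>t. t powr (real (n + 1) - 1) * (1 - t) powr (real n - 1)) has_integral Beta (real (n + 1)) (real n)) {0<..<1}"
    using has_integral_Beta_real[of "real (n + 1)" "real n"] assms by (simp add: has_integral_Icc_iff_Ioo)
  then have "((\<lambda>t. n * (t powr (real (n + 1) - 1) * (1 - t) powr (real n - 1))) has_integral n * Beta (real (n + 1)) (real n)) {0<..<1}"
    by (rule has_integral_mult_right)
  also have "?this \<longleftrightarrow> ((\<lambda>r. n * (1 - r) ^ (n - 1) * r ^ n) has_integral n * Beta (real (n + 1)) (real n)) {0<..<1}"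
  \<comment> \<open>On the open interval both bases are positive, so \<open>powr\<close> agrees with
    the natural power.\<close>
  proof (rule has_integral_cong)
    fix t :: real assume t: "t \<in> {0<..<1}"
    then have "(1 - t) powr (real n - 1) = (1 - t) ^ (n - 1)"
      using powr_realpow[of "1 - t" "n - 1"] assms by (simp add: of_nat_diff)
    moreover have "t powr (real (n + 1) - 1) = t ^ n"
      using powr_realpow[of t n] t by simp
    ultimately show "n * (t powr (real (n + 1) - 1) * (1 - t) powr (real n - 1)) = n * (1 - t) ^ (n - 1) * t ^ n"
      by simp
  qed
  finally have "(\<integral>\<^sup>+r. ennreal (n * (1 - r) ^ (n - 1) * r ^ n) * indicator {0<..<1} r \<partial>lborel) =
      ennreal (n * Beta (real (n + 1)) (real n))"
    by (intro nn_integral_has_integral_lebesgue') auto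
  moreover have "n * Beta (real (n + 1)) (real n) = 1 / real ((2 * n) choose n)"
  proof -
    obtain m where m: "n = Suc m" using assms by (cases n) auto
    have "Gamma (real n) = fact m" "Gamma (real (n + 1)) = fact n" "Gamma (real (n + 1) + real n) = fact (2 * n)"
      using Gamma_fact[of m, where 'a=real] Gamma_fact[of n, where 'a=real] Gamma_fact[of "2 * n", where 'a=real] m
      by (simp_all add: algebra_simps)
    then have "n * Beta (real (n + 1)) (real n) = fact n * fact n / fact (2 * n)"
      by (simp add: Beta_def m algebra_simps)
    also have "\<dots> = 1 / real ((2 * n) choose n)"
      by (subst binomial_fact) auto
    finally show ?thesis .
  qed
  ultimately show ?thesis by simp
qed

text \<open>An antiderivative is -(1 - r)^n, which vanishes at r = 1 because
  \<open>n > 0\<close>.\<close>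

lemma nn_integral_power_tail:
  assumes "n > 0" "0 \<le> \<rho>" "\<rho> \<le> 1"
  shows "(\<integral>\<^sup>+r. ennreal (n * (1 - r) ^ (n - 1)) * indicator {\<rho>..1} r \<partial>lborel) = ennreal ((1 - \<rho>) ^ n)"
proof -
  have "(\<integral>\<^sup>+r. ennreal (n * (1 - r) ^ (n - 1)) * indicator {\<rho>..1} r \<partial>lborel) =
     ennreal (- ((1 - 1) ^ n) - - ((1 - \<rho>) ^ n))"
    using assms by (intro nn_integral_FTC_Icc) (auto intro!: derivative_eq_intros)
  with assms show ?thesis by (simp add: power_0_left)
qed


section \<open>Rogers-Shephard inequality for open convex sets\<close>

text \<open>The preimage of \<open>U\<close> is the translate U + z, and its overlap with
  \<open>U\<close> contains a copy of \<open>U\<close> shrunk by the factor 1 - r.\<close>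

lemma emeasure_lborel_inter_translate_ge:
  fixes U :: "'a::euclidean_space set"
  assumes U: "open U" "convex U" and r: "0 < r" "r < 1"
    and z: "(1 / r) *\<^sub>R z \<in> difference_body U"
  shows "ennreal ((1 - r) ^ DIM('a)) * emeasure lborel U \<le> emeasure lborel (U \<inter> (\<lambda>x. x - z) -` U)"
proof -
  obtain a b where ab: "a \<in> U" "b \<in> U" "(1 / r) *\<^sub>R z = a - b" using z by auto
  have z_eq: "z = r *\<^sub>R a - r *\<^sub>R b"
    using arg_cong[OF ab(3), of "\<lambda>v. r *\<^sub>R v"] r by (simp add: scaleR_diff_right)
  have "open ((\<lambda>x. x - z) -` U)"
    using U by (intro open_vimage continuous_intros)
  then have meas: "U \<inter> (\<lambda>x. x - z) -` U \<in> sets lborel" using U by auto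
  have "ennreal ((1 - r) ^ DIM('a)) * emeasure lborel U =
      emeasure lebesgue ((\<lambda>x. (1 - r) *\<^sub>R x + r *\<^sub>R a) ` U)"
    using U r by (simp add: emeasure_lebesgue_affine)
  also have "\<dots> \<le> emeasure lebesgue (U \<inter> (\<lambda>x. x - z) -` U)"
  proof (rule emeasure_mono)
    \<comment> \<open>Subtracting z = ra - rb from (1 - r)x + ra leaves (1 - r)x + rb; both points
      are convex combinations of points of \<open>U\<close>.\<close>
    show "(\<lambda>x. (1 - r) *\<^sub>R x + r *\<^sub>R a) ` U \<subseteq> U \<inter> (\<lambda>x. x - z) -` U"
      using convexD[OF U(2) _ ab(1), of _ "1 - r" r] convexD[OF U(2) _ ab(2), of _ "1 - r" r] r
      by (auto simp: z_eq algebra_simps)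
  qed (use meas in auto)
  finally show ?thesis using meas by simp
qed

text \<open>
  For convex \<open>U\<close> the integral on the left equals \<open>(1 - \<rho>)^n\<close>, where \<open>\<rho>\<close> is the gauge of \<open>z\<close>
  with respect to the difference body (and \<open>0\<close> outside of it). Writing it as an integral avoids the
  gauge and prepares for Tonelli's theorem.
\<close>

lemma nn_integral_gauge_weight_le:
  fixes U :: "'a::euclidean_space set"
  assumes U: "open U" "convex U" and fin: "emeasure lborel U < \<infinity>"
  shows "emeasure lborel U * (\<integral>\<^sup>+r. ennreal (DIM('a) * (1 - r) ^ (DIM('a) - 1)) *
      indicator {r. 0 < r \<and> r < 1 \<and> (1 / r) *\<^sub>R z \<in> difference_body U} r \<partial>lborel)
    \<le> emeasure lborel (U \<inter> (\<lambda>x. x - z) -` U)" (is "_ * nn_integral _ ?w \<le> ?g")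
proof -
  define R where "R = {r::real. 0 < r \<and> r < 1 \<and> (1 / r) *\<^sub>R z \<in> difference_body U}"
  show ?thesis
  proof (cases "R = {}")
    case True
    then show ?thesis unfolding R_def by (simp only:) simp
  next
    case False
    have "?g \<le> emeasure lborel U" using U by (intro emeasure_mono) auto
    then obtain v g where v: "emeasure lborel U = ennreal v" "0 \<le> v" and g: "?g = ennreal g" "0 \<le> g"
      using fin by (metis ennreal_cases infinity_ennreal_def less_le_not_le top_greatest order.strict_trans1)
    define \<rho> where "\<rho> = Inf R"
    have bdd: "bdd_below R" by (auto simp: R_def intro!: bdd_belowI[of _ 0])
    have \<rho>: "0 \<le> \<rho>" "\<rho> \<le> 1" "\<And>r. r \<in> R \<Longrightarrow> \<rho> \<le> r"
    proof -
      show "0 \<le> \<rho>" unfolding \<rho>_def using False by (intro cInf_greatest) (auto simp: R_def)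
      show le: "\<And>r. r \<in> R \<Longrightarrow> \<rho> \<le> r" unfolding \<rho>_def using bdd by (rule cInf_lower[rotated])
      obtain r where "r \<in> R" using False by auto
      with le[OF this] show "\<rho> \<le> 1" by (auto simp: R_def)
    qed
    \<comment> \<open>The infimum \<open>\<rho>\<close> need not belong to \<open>R\<close>, so the
      bound is carried over to it through a closed set containing \<open>R\<close>.\<close>
    have "R \<subseteq> {r. (1 - r) ^ DIM('a) * v \<le> g}"
    proof safe
      fix r assume "r \<in> R"
      with emeasure_lborel_inter_translate_ge[OF U, of r z] v g
      show "(1 - r) ^ DIM('a) * v \<le> g" by (auto simp: R_def ennreal_mult'[symmetric])
    qed
    moreover have "closed {r. (1 - r) ^ DIM('a) * v \<le> g}"
      by (intro closed_Collect_le continuous_intros)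
    ultimately have "closure R \<subseteq> {r. (1 - r) ^ DIM('a) * v \<le> g}"
      by (rule closure_minimal)
    with closure_contains_Inf[OF False bdd] have "(1 - \<rho>) ^ DIM('a) * v \<le> g"
      by (auto simp: \<rho>_def)
    moreover have "nn_integral lborel ?w \<le> ennreal ((1 - \<rho>) ^ DIM('a))"
    proof -
      \<comment> \<open>\<open>R\<close> lies in \<open>{\<rho>..1}\<close>, so integrating over the
        whole interval can only increase the value.\<close>
      have "nn_integral lborel ?w \<le> (\<integral>\<^sup>+r. ennreal (DIM('a) * (1 - r) ^ (DIM('a) - 1)) * indicator {\<rho>..1} r \<partial>lborel)"
        using \<rho>(3) by (intro nn_integral_mono) (auto simp: R_def indicator_def)
      with nn_integral_power_tail[of "DIM('a)" \<rho>] \<rho> show ?thesis by simp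
    qed
    ultimately show ?thesis
      using v g \<rho> mult_left_mono[of "nn_integral lborel ?w" "ennreal ((1 - \<rho>) ^ DIM('a))" "ennreal v"]
      by (auto simp: ennreal_mult'[symmetric] mult.commute intro: order_trans ennreal_leI)
  qed
qed

text \<open>This is the total integral of the convolution-type product 1_U(x) 1_U(x - z);
  integrating over \<open>z\<close> first gives vol U for every \<open>x\<close> in
  \<open>U\<close>.\<close>

lemma nn_integral_emeasure_inter_translate:
  fixes U :: "'a::euclidean_space set"
  assumes U: "open U"
  shows "(\<integral>\<^sup>+z. emeasure lborel (U \<inter> (\<lambda>x. x - z) -` U) \<partial>lborel) = emeasure lborel U * emeasure lborel U"
proof -
  have [measurable]: "U \<in> sets borel" using U by auto
  have "(\<integral>\<^sup>+z. emeasure lborel (U \<inter> (\<lambda>x. x - z) -` U) \<partial>lborel) =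
      (\<integral>\<^sup>+z. \<integral>\<^sup>+x. indicator U x * indicator U (x - z) \<partial>lborel \<partial>lborel)"
  proof (rule nn_integral_cong)
    fix z :: 'a
    have "open ((\<lambda>x. x - z) -` U)"
      using U by (intro open_vimage continuous_intros)
    then have "emeasure lborel (U \<inter> (\<lambda>x. x - z) -` U) = (\<integral>\<^sup>+x. indicator (U \<inter> (\<lambda>x. x - z) -` U) x \<partial>lborel)"
      using U by (intro nn_integral_indicator[symmetric]) auto
    also have "\<dots> = (\<integral>\<^sup>+x. indicator U x * indicator U (x - z) \<partial>lborel)"
      by (intro nn_integral_cong) (auto simp: indicator_def)
    finally show "emeasure lborel (U \<inter> (\<lambda>x. x - z) -` U) = \<dots>" .
  qed
  also have "\<dots> = (\<integral>\<^sup>+x. \<integral>\<^sup>+z. indicator U x * indicator U (x - z) \<partial>lborel \<partial>lborel)"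
    by (rule lborel_pair.Fubini') measurable
  also have "\<dots> = (\<integral>\<^sup>+x. indicator U x * emeasure lborel U \<partial>lborel)"
  proof (rule nn_integral_cong)
    fix x :: 'a
    \<comment> \<open>The preimage is a translate of the reflected set, and the scaling factor -1
      preserves volume.\<close>
    have img: "(\<lambda>z. x - z) -` U = (\<lambda>y. (-1) *\<^sub>R y + x) ` U"
      by (auto simp: image_iff intro!: bexI[of _ "x - _"])
    have op: "open ((\<lambda>z. x - z) -` U)"
      using U by (intro open_vimage continuous_intros)
    have "(\<integral>\<^sup>+z. indicator U (x - z) \<partial>lborel) = (\<integral>\<^sup>+z. indicator ((\<lambda>z. x - z) -` U) z \<partial>lborel)"
      by (intro nn_integral_cong) (auto simp: indicator_def)
    also have "\<dots> = emeasure lebesgue ((\<lambda>z. x - z) -` U)"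
      using op by simp
    also have "\<dots> = emeasure lborel U"
      unfolding img emeasure_lebesgue_affine by simp
    finally show "(\<integral>\<^sup>+z. indicator U x * indicator U (x - z) \<partial>lborel) = indicator U x * emeasure lborel U"
      by (simp add: nn_integral_cmult)
  qed
  also have "\<dots> = emeasure lborel U * emeasure lborel U"
    by (simp add: nn_integral_multc)
  finally show ?thesis .
qed

text \<open>For fixed \<open>r\<close> in (0, 1) the admissible \<open>z\<close> form the dilate rD
  of volume r^n vol D. Integrating over \<open>z\<close> first therefore leaves the Beta
  integral.\<close>

lemma nn_integral_gauge_weight:
  fixes D :: "'a::euclidean_space set"
  assumes D: "open D"
  shows "(\<integral>\<^sup>+z. \<integral>\<^sup>+r. ennreal (DIM('a) * (1 - r) ^ (DIM('a) - 1)) *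
      indicator {r. 0 < r \<and> r < 1 \<and> (1 / r) *\<^sub>R z \<in> D} r \<partial>lborel \<partial>lborel) =
    ennreal (1 / real ((2 * DIM('a)) choose DIM('a))) * emeasure lborel D"
proof -
  have [measurable]: "D \<in> sets borel" using D by auto
  have [measurable]: "Measurable.pred (borel \<Otimes>\<^sub>M borel) (\<lambda>p. (1 / snd p) *\<^sub>R fst p \<in> D)"
    by measurable
  have "(\<integral>\<^sup>+z. \<integral>\<^sup>+r. ennreal (DIM('a) * (1 - r) ^ (DIM('a) - 1)) *
      indicator {r. 0 < r \<and> r < 1 \<and> (1 / r) *\<^sub>R z \<in> D} r \<partial>lborel \<partial>lborel) =
    (\<integral>\<^sup>+z. \<integral>\<^sup>+r. ennreal (DIM('a) * (1 - r) ^ (DIM('a) - 1)) *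
      (indicator {0<..<1} r * indicator D ((1 / r) *\<^sub>R z)) \<partial>lborel \<partial>lborel)"
    by (intro nn_integral_cong) (auto simp: indicator_def)
  also have "\<dots> = (\<integral>\<^sup>+r. \<integral>\<^sup>+z. ennreal (DIM('a) * (1 - r) ^ (DIM('a) - 1)) *
      (indicator {0<..<1} r * indicator D ((1 / r) *\<^sub>R z)) \<partial>lborel \<partial>lborel)"
    by (rule lborel_pair.Fubini'[symmetric]) measurable
  also have "\<dots> = (\<integral>\<^sup>+r. ennreal (DIM('a) * (1 - r) ^ (DIM('a) - 1) * r ^ DIM('a)) * indicator {0<..<1} r *
      emeasure lborel D \<partial>lborel)"
  proof (rule nn_integral_cong)
    fix r :: real
    show "(\<integral>\<^sup>+z. ennreal (DIM('a) * (1 - r) ^ (DIM('a) - 1)) *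
        (indicator {0<..<1} r * indicator D ((1 / r) *\<^sub>R z)) \<partial>lborel) =
      ennreal (DIM('a) * (1 - r) ^ (DIM('a) - 1) * r ^ DIM('a)) * indicator {0<..<1} r * emeasure lborel D"
    proof (cases "0 < r \<and> r < 1")
      case True
      then have img: "(\<lambda>z. (1 / r) *\<^sub>R z) -` D = (\<lambda>y. r *\<^sub>R y + 0) ` D"
        by (auto simp: image_iff intro!: bexI[of _ "(1 / r) *\<^sub>R _"])
      have op: "open ((\<lambda>z. (1 / r) *\<^sub>R z) -` D)"
        using D by (intro open_vimage continuous_intros)
      have "(\<integral>\<^sup>+z. indicator D ((1 / r) *\<^sub>R z) \<partial>lborel) = (\<integral>\<^sup>+z. indicator ((\<lambda>z. (1 / r) *\<^sub>R z) -` D) z \<partial>lborel)"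
        by (intro nn_integral_cong) (auto simp: indicator_def)
      also have "\<dots> = emeasure lebesgue ((\<lambda>z. (1 / r) *\<^sub>R z) -` D)"
        using op by simp
      also have "\<dots> = ennreal (r ^ DIM('a)) * emeasure lborel D"
        using True unfolding img emeasure_lebesgue_affine by simp
      finally have "(\<integral>\<^sup>+z. indicator D ((1 / r) *\<^sub>R z) \<partial>lborel) = ennreal (r ^ DIM('a)) * emeasure lborel D" .
      with True show ?thesis
        by (simp add: nn_integral_cmult ennreal_mult' mult.assoc)
    qed auto
  qed
  also have "\<dots> = ennreal (1 / real ((2 * DIM('a)) choose DIM('a))) * emeasure lborel D"
    by (subst nn_integral_multc) (auto simp: nn_integral_Beta_nat simp del: One_nat_def)
  finally show ?thesis .
qed

text \<open>Integrating the pointwise bound over \<open>z\<close> gives vol U vol(U - U) / C <= (vol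
  U)^2, where C is the binomial coefficient. Cancelling vol U requires it to be positive and finite,
  hence the case split.\<close>

lemma Rogers_Shephard_open:
  fixes U :: "'a::euclidean_space set"
  assumes U: "open U" "convex U"
  shows "emeasure lborel (difference_body U) \<le> ennreal (real ((2 * DIM('a)) choose DIM('a))) * emeasure lborel U"
proof -
  let ?C = "real ((2 * DIM('a)) choose DIM('a))"
  let ?V = "emeasure lborel U"
  have C: "?C > 0" by simp
  consider "U = {}" | "?V = \<infinity>" | "U \<noteq> {}" "?V < \<infinity>" by (metis infinity_ennreal_def top.not_eq_extremum)
  then show ?thesis
  proof cases
    case 2
    with C show ?thesis by (simp add: ennreal_mult_top)
  next
    case 3
    \<comment> \<open>A nonempty open set has positive volume, which permits the cancellation
      below.\<close>
    have "U \<notin> null_sets lebesgue"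
      using open_not_negligible[OF U(1) 3(1)] by (simp add: negligible_iff_null_sets)
    then have V0: "?V \<noteq> 0" using U by (auto simp: null_sets_def)
    have D: "open (difference_body U)" using U by (intro open_difference_body)
    have [measurable]: "difference_body U \<in> sets borel" using D by auto
    have meas: "(\<lambda>z. \<integral>\<^sup>+r. ennreal (DIM('a) * (1 - r) ^ (DIM('a) - 1)) *
        indicator {r. 0 < r \<and> r < 1 \<and> (1 / r) *\<^sub>R z \<in> difference_body U} r \<partial>lborel) \<in> borel_measurable lborel"
      by measurable
    have "?V * (ennreal (1 / ?C) * emeasure lborel (difference_body U)) =
      (\<integral>\<^sup>+z. ?V * (\<integral>\<^sup>+r. ennreal (DIM('a) * (1 - r) ^ (DIM('a) - 1)) *
        indicator {r. 0 < r \<and> r < 1 \<and> (1 / r) *\<^sub>R z \<in> difference_body U} r \<partial>lborel) \<partial>lborel)"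
      unfolding nn_integral_cmult[OF meas] nn_integral_gauge_weight[OF D] ..
    also have "\<dots> \<le> (\<integral>\<^sup>+z. emeasure lborel (U \<inter> (\<lambda>x. x - z) -` U) \<partial>lborel)"
      using nn_integral_gauge_weight_le[OF U 3(2)] by (intro nn_integral_mono) auto
    also have "\<dots> = ?V * ?V"
      by (rule nn_integral_emeasure_inter_translate[OF U(1)])
    finally have "ennreal (1 / ?C) * emeasure lborel (difference_body U) \<le> ?V"
      using V0 3(2) by (subst (asm) ennreal_mult_le_mult_iff) (auto simp: less_top)
    then have "ennreal ?C * (ennreal (1 / ?C) * emeasure lborel (difference_body U)) \<le> ennreal ?C * ?V"
      by (rule mult_left_mono) simp
    moreover have "ennreal ?C * ennreal (1 / ?C) = 1"
      using C by (subst ennreal_mult'[symmetric]) auto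
    ultimately show ?thesis by (simp flip: mult.assoc)
  qed simp
qed

section \<open>Rogers-Shephard inequality for arbitrary convex sets\<close>

text \<open>If the interior is empty, \<open>K\<close> lies in a hyperplane and its differences in
  the parallel one through the origin, a null set. Otherwise the open case applies to the interior,
  and only a null frontier separates the two difference bodies.\<close>

theorem Rogers_Shephard:
  fixes K :: "'a::euclidean_space set"
  assumes K: "convex K"
  shows "emeasure lebesgue (difference_body K) \<le>
    ennreal (real ((2 * DIM('a)) choose DIM('a))) * emeasure lebesgue K"
proof (cases "interior K = {}")
  case True
  obtain a b where a: "a \<noteq> 0" and sub: "K \<subseteq> {x. a \<bullet> x = b}"
    using empty_interior_subset_hyperplane[OF K True] by blast
  have "difference_body K \<subseteq> {x. a \<bullet> x = 0}"
  proof clarify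
    fix x y assume "x \<in> K" "y \<in> K"
    with sub have "a \<bullet> x = b" "a \<bullet> y = b" by auto
    then show "a \<bullet> (x - y) = 0" by (simp add: inner_diff_right)
  qed
  then have "negligible (difference_body K)"
    using negligible_hyperplane[of a 0] a negligible_subset by blast
  then show ?thesis by (simp add: negligible_iff_null_sets null_sets_def)
next
  case False
  define U where "U = interior K"
  have U: "open U" "convex U" using K by (auto simp: U_def convex_interior)
  define D where "D = difference_body U"
  have D: "open D" "convex D" using U by (auto simp: D_def open_difference_body convex_difference_body)
  have K_cl: "K \<subseteq> closure U"
    unfolding U_def convex_closure_interior[OF K False] by (rule closure_subset)
  \<comment> \<open>Points of \<open>K\<close> are limits of interior points, so their differences
    are limits of points of \<open>D\<close>.\<close>
  have "difference_body K \<subseteq> closure D"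
  proof clarify
    fix a b assume "a \<in> K" "b \<in> K"
    then obtain s t where "\<forall>n. s n \<in> U" "s \<longlonglongrightarrow> a" "\<forall>n. t n \<in> U" "t \<longlonglongrightarrow> b"
      using K_cl by (meson closure_sequential subsetD)
    then have "\<forall>n. s n - t n \<in> D" "(\<lambda>n. s n - t n) \<longlonglongrightarrow> a - b"
      by (auto simp: D_def intro: tendsto_diff)
    then show "a - b \<in> closure D"
      unfolding closure_sequential by (intro exI[of _ "\<lambda>n. s n - t n"] conjI)
  qed
  then have "emeasure lebesgue (difference_body K) \<le> emeasure lebesgue (D \<union> frontier D)"
    using D(1) frontier_closed[of D]
    by (intro emeasure_mono sets.Un) (auto simp: closure_Un_frontier)
  also have "\<dots> = emeasure lebesgue D"
    using negligible_convex_frontier[OF D(2)] D(1)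
    by (intro emeasure_Un_null_set) (auto simp: negligible_iff_null_sets)
  also have "\<dots> \<le> ennreal (real ((2 * DIM('a)) choose DIM('a))) * emeasure lebesgue U"
    using Rogers_Shephard_open[OF U] D U by (simp add: D_def)
  also have "\<dots> \<le> ennreal (real ((2 * DIM('a)) choose DIM('a))) * emeasure lebesgue K"
    using convex_imp_sets_lebesgue[OF K] by (intro mult_left_mono emeasure_mono) (auto simp: U_def interior_subset)
  finally show ?thesis .
qed

section \<open>Superlevel sets of the difference function\<close>

lemma quasi_concave_convex_superlevel:
  assumes "quasi_concave f"
  shows "convex {x. c < f x}"
proof (rule convexI)
  fix x y and u v :: real
  assume "x \<in> {x. c < f x}" "y \<in> {x. c < f x}" "0 \<le> u" "0 \<le> v" "u + v = 1"
  moreover from this have "min (f x) (f y) \<le> f (u *\<^sub>R x + (1 - u) *\<^sub>R y)"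
    using assms unfolding quasi_concave_def by auto
  moreover have "v = 1 - u" using \<open>u + v = 1\<close> by simp
  ultimately show "u *\<^sub>R x + v *\<^sub>R y \<in> {x. c < f x}"
    by (auto simp: min_def split: if_splits)
qed

text \<open>Strictness makes the identity exact: \<open>c\<close> is below a supremum iff it is
  below some member, whereas the supremum need not be attained. The summand 0 gives the affine form
  used by \<open>emeasure_lebesgue_affine\<close>.\<close>

lemma superlevel_difference_function:
  "{z. c < difference_function_minus_infinity f z} =
    (\<lambda>x. (1 / 2) *\<^sub>R x + 0) ` difference_body {x. c < f x}"
proof safe
  fix z assume "c < difference_function_minus_infinity f z"
  then obtain x y where "(1 / 2 :: real) *\<^sub>R (x + y) = z" "c < f x" "c < f (- y)"
    by (auto simp: difference_function_minus_infinity_def less_Sup_iff)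
  then show "z \<in> (\<lambda>x. (1 / 2) *\<^sub>R x + 0) ` difference_body {x. c < f x}"
    by (intro image_eqI[of _ _ "x - (- y)"]) (simp, blast)
next
  fix a b assume "c < f a" "c < f b"
  then show "c < difference_function_minus_infinity f ((1 / 2) *\<^sub>R (a - b) + 0)"
    unfolding difference_function_minus_infinity_def less_Sup_iff
    by (intro bexI[of _ "min (f a) (f (- (- b)))"] CollectI exI[of _ a] exI[of _ "- b"]) auto
qed

theorem theorem4p3:
  fixes f :: "real ^ 'n \<Rightarrow> ennreal"
  assumes "quasi_concave f"
    and "in_L1 f"
  shows "difference_function_minus_infinity f \<in> borel_measurable lebesgue \<and>
    (\<integral>\<^sup>+ x. difference_function_minus_infinity f x \<partial>lebesgue)
      \<le> ennreal (1 / 2 ^ CARD('n) * real ((2 * CARD('n)) choose CARD('n)))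
          * (\<integral>\<^sup>+ x. f x \<partial>lebesgue)"
proof
  interpret lebesgue: sigma_finite_measure "lebesgue :: (real ^ 'n) measure"
    by (intro sigma_finite_measure_completion sigma_finite_lborel)
  let ?\<Delta> = "difference_function_minus_infinity f"
  note conv = quasi_concave_convex_superlevel[OF assms(1)]
  show meas: "?\<Delta> \<in> borel_measurable lebesgue"
  proof (rule borel_measurableI_greater)
    fix c
    \<comment> \<open>Measurability follows from convexity: each superlevel set is half the
      difference body of a convex set.\<close>
    have "convex {z. c < ?\<Delta> z}"
      unfolding superlevel_difference_function
      by (simp only: add_0_right) (intro convex_scaling convex_difference_body conv)
    then show "{z \<in> space lebesgue. c < ?\<Delta> z} \<in> sets lebesgue"
      by (simp add: convex_imp_sets_lebesgue)
  qed
  show "(\<integral>\<^sup>+ x. ?\<Delta> x \<partial>lebesgue)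
      \<le> ennreal (1 / 2 ^ CARD('n) * real ((2 * CARD('n)) choose CARD('n))) * (\<integral>\<^sup>+ x. f x \<partial>lebesgue)"
  proof (rule lebesgue.nn_integral_le_if_superlevel_le[OF _ meas])
    show "f \<in> borel_measurable lebesgue" using assms(2) by (simp add: in_L1_def)
    fix t :: real
    \<comment> \<open>The dilation by 1/2 supplies the factor 1/2^n, with n =
      \<open>CARD('n)\<close> the dimension.\<close>
    have "emeasure lebesgue {z. ennreal t < ?\<Delta> z} =
        ennreal (1 / 2 ^ CARD('n)) * emeasure lebesgue (difference_body {x. ennreal t < f x})"
      unfolding superlevel_difference_function emeasure_lebesgue_affine
      by (simp add: power_one_over)
    also have "\<dots> \<le> ennreal (1 / 2 ^ CARD('n)) *
        (ennreal (real ((2 * CARD('n)) choose CARD('n))) * emeasure lebesgue {x. ennreal t < f x})"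
      using Rogers_Shephard[OF conv[of "ennreal t"]] by (intro mult_left_mono) auto
    finally show "emeasure lebesgue {z \<in> space lebesgue. ennreal t < ?\<Delta> z}
      \<le> ennreal (1 / 2 ^ CARD('n) * real ((2 * CARD('n)) choose CARD('n))) *
        emeasure lebesgue {x \<in> space lebesgue. ennreal t < f x}"
      by (subst ennreal_mult) (auto simp: mult.assoc)
  qed
qed

end
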